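(* Let $X$ be a reflexive Banach space. Assume that $A,B\colon X\to X$ are sequentially weakly continuous maps satisfying: (i) $A(B_R)\subset B_R$ for some $R>0$, where $B_R=\{u\in X:\|u\|\le R\}$; (ii) $B$ is Lipschitz and expanding on $X$. Then for every $\lambda\ge 0$ there exists $u\in X$ with $Au+\lambda Bu=u$.
   Context: A map $T\colon X\to X$ is Lipschitz if there is a constant $\|T\|_{Lip}$ such that $\|Tu-Tv\|\le\|T\|_{Lip}\|u-v\|$ for all $u,v\in X$. A map $T\colon X\to X$ is called expanding if $\|u\|\le\|u-\lambda Tu\|$ holds for any $\lambda>0$ and all $u\in X$. A map is sequentially weakly continuous if $u_n\rightharpoonup u$ implies $Tu_n\rightharpoonup Tu$. *)

theory Defs
  imports "HOL-Analysis.Analysis"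
begin

text \<open>The topological dual of a real normed space \<open>'a\<close> is the normed space
  \<open>'a \<Rightarrow>\<^sub>L real\<close> of bounded linear functionals.\<close>

lift_definition bidual_embedding ::
    "'a::real_normed_vector \<Rightarrow> (('a \<Rightarrow>\<^sub>L real) \<Rightarrow>\<^sub>L real)"
  is "\<lambda>x \<phi>. blinfun_apply \<phi> x"
  by (rule blinfun.bounded_linear_left)

definition reflexive_space :: "'a::real_normed_vector itself \<Rightarrow> bool" where
  "reflexive_space _ \<longleftrightarrow> surj (bidual_embedding :: 'a \<Rightarrow> (('a \<Rightarrow>\<^sub>L real) \<Rightarrow>\<^sub>L real))"

definition weakly_converges :: "(nat \<Rightarrow> 'a::real_normed_vector) \<Rightarrow> 'a \<Rightarrow> bool" where
  "weakly_converges u l \<longleftrightarrow>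
     (\<forall>\<phi>::'a \<Rightarrow>\<^sub>L real. (\<lambda>n. blinfun_apply \<phi> (u n)) \<longlonglongrightarrow> blinfun_apply \<phi> l)"

definition seq_weakly_continuous :: "('a::real_normed_vector \<Rightarrow> 'a) \<Rightarrow> bool" where
  "seq_weakly_continuous T \<longleftrightarrow>
     (\<forall>u l. weakly_converges u l \<longrightarrow> weakly_converges (\<lambda>n. T (u n)) (T l))"

text \<open>The condition compares \<open>u\<close> with \<open>u - \<lambda> T u\<close> pointwise; it is not a condition
  on differences \<open>u - v\<close>, so for nonlinear \<open>T\<close> it is weaker than dissipativity plus \<open>T 0 = 0\<close>.\<close>

definition expanding :: "('a::real_normed_vector \<Rightarrow> 'a) \<Rightarrow> bool" where
  "expanding T \<longleftrightarrow> (\<forall>c>0. \<forall>u. norm u \<le> norm (u - c *\<^sub>R T u))"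

end

theory Submission
  imports Defs "HOL-Complex_Analysis.Great_Picard"
begin

text \<open>For small \<open>e > 0\<close> the map \<open>I - e B\<close> is bijective by the contraction principle. Its inverse \<open>S\<close>
  does not increase norms because \<open>B\<close> is expanding, and by weak sequential compactness it is weakly
  sequentially continuous on bounded sets. Put \<open>\<theta> = e / c\<close>, which is at most \<open>1\<close> for small \<open>e\<close>.
  With \<open>w = u - e B u\<close>, i.e. \<open>u = S w\<close>, the equation \<open>A u + c B u = u\<close> becomes
  \<open>w = (1 - \<theta>) S w + \<theta> A (S w)\<close>, whose right-hand side is a convex combination and hence maps
  the ball to itself for every \<open>c\<close>. So \<open>w\<close> exists by the Schauder--Tychonoff theorem for the weak topology.\<close>

section \<open>The Hahn--Banach theorem\<close>

text \<open>When \<open>c * L \<ge> 1\<close> for the Lipschitz constant \<open>L\<close>, the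
  contraction principle says nothing about \<open>I - c B\<close>. Multiplying the equation by
  \<open>\<theta>\<close> and adding \<open>(1 - \<theta>) u\<close> to both sides lowers the
  coefficient of \<open>B\<close> from \<open>c\<close> to \<open>e = \<theta> c\<close>, and the
  price is a convex combination on the other side. Expanding is a pointwise condition, so the
  inverse \<open>S\<close> is only known not to increase norms; this suffices, because
  \<open>S\<close> only has to keep the ball invariant.

  The second obstacle is that all continuity is sequential, while the weak topology of the ball need
  not be metrizable. The fixed point theorem is therefore itself proved with sequences: points that
  are almost fixed as seen by finitely many functionals, found in a separable subspace, have a
  weakly convergent subsequence by reflexivity. Hahn-Banach enters throughout, since it makes weak
  limits unique, closed subspaces weakly closed, and bounded sequences weakly compact.\<close>

definition sublinear :: "('a::real_vector \<Rightarrow> real) \<Rightarrow> bool" where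
  "sublinear p \<longleftrightarrow> (\<forall>x y. p (x + y) \<le> p x + p y) \<and> (\<forall>c>0. \<forall>x. p (c *\<^sub>R x) \<le> c * p x) \<and> p 0 = 0"

lemma sublinearI:
  assumes "\<And>x y. p (x + y) \<le> p x + p y" "\<And>c x. c > 0 \<Longrightarrow> p (c *\<^sub>R x) \<le> c * p x" "p 0 = 0"
  shows "sublinear p"
  using assms unfolding sublinear_def by blast

lemma
  assumes "sublinear p"
  shows sublinear_add: "p (x + y) \<le> p x + p y"
    and sublinear_0: "p 0 = 0"
    and sublinear_neg: "- p (- x) \<le> p x"
proof -
  have a: "p (x + y) \<le> p x + p y" for x y
    using assms unfolding sublinear_def by blast
  have 0: "p 0 = 0"
    using assms unfolding sublinear_def by blast
  show "p (x + y) \<le> p x + p y" "p 0 = 0" by fact+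
  show "- p (- x) \<le> p x" using a[of x "-x"] 0 by simp
qed

text \<open>Scaling back by \<open>1 / c\<close> gives the reverse inequality. The definition can
  thus ask for one inequality only, the one that the infima below satisfy directly.\<close>

lemma sublinear_scale:
  assumes "sublinear p" "c \<ge> 0"
  shows "p (c *\<^sub>R x) = c * p x"
proof (cases "c = 0")
  case True
  then show ?thesis using sublinear_0[OF assms(1)] by simp
next
  case False
  then have c: "c > 0" using assms by simp
  then have 1: "p (c *\<^sub>R x) \<le> c * p x"
    using assms(1) unfolding sublinear_def by blast
  have "p ((1/c) *\<^sub>R (c *\<^sub>R x)) \<le> (1/c) * p (c *\<^sub>R x)"
    using assms(1) c unfolding sublinear_def by (meson divide_pos_pos zero_less_one)
  then have "p x \<le> p (c *\<^sub>R x) / c" using c by simp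
  then have "c * p x \<le> p (c *\<^sub>R x)" using c by (simp add: field_simps)
  with 1 show ?thesis by simp
qed

text \<open>Applied to a minimal \<open>m\<close> this gives \<open>m (- x0) = - m x0\<close>; applied to an arbitrary \<open>m\<close> it forces a
  linear functional below \<open>q\<close> to agree with \<open>m\<close> at \<open>x0\<close>.\<close>

lemma sublinear_directional:
  assumes m: "sublinear m"
  obtains q where "sublinear q" "\<And>x. q x \<le> m x" "q (- x0) \<le> - m x0"
proof -
  let ?f = "\<lambda>x t. m (x + t *\<^sub>R x0) - t * m x0"
  \<comment> \<open>Lowering \<open>m\<close> along the ray through \<open>x0\<close>: the infimum
    is again sublinear because \<open>{0..}\<close> is closed under sums and positive multiples, and
    \<open>t = 1\<close> gives the bound at \<open>- x0\<close>.\<close>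
  define q where "q x = (INF t\<in>{0..}. ?f x t)" for x
  have lb: "- m (- x) \<le> ?f x t" if "t \<ge> 0" for x t
  proof -
    have "m (t *\<^sub>R x0) \<le> m (x + t *\<^sub>R x0) + m (- x)"
      using sublinear_add[OF m, of "x + t *\<^sub>R x0" "-x"] by simp
    then show ?thesis using sublinear_scale[OF m that] by simp
  qed
  have q_le: "q x \<le> ?f x t" if "t \<ge> 0" for x t
    unfolding q_def by (rule cINF_lower) (use lb that in \<open>auto intro!: bdd_belowI2\<close>)
  have q_ge: "a \<le> q x" if "\<And>t. t \<ge> 0 \<Longrightarrow> a \<le> ?f x t" for x a
    unfolding q_def by (rule cINF_greatest) (use that in auto)
  show thesis
  proof
    show "sublinear q"
    proof (rule sublinearI)
      fix x y
      have "q (x + y) - ?f x s \<le> ?f y t" if "s \<ge> 0" "t \<ge> 0" for s t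
        using q_le[of "s + t" "x + y"] that
          sublinear_add[OF m, of "x + s *\<^sub>R x0" "y + t *\<^sub>R x0"]
        by (simp add: algebra_simps)
      then have "q (x + y) - q y \<le> ?f x s" if "s \<ge> 0" for s
        using q_ge[of "q (x + y) - ?f x s" y] that by fastforce
      then show "q (x + y) \<le> q x + q y"
        using q_ge[of "q (x + y) - q y" x] by simp
    next
      fix c :: real and x assume c: "c > 0"
      have "q (c *\<^sub>R x) / c \<le> ?f x t" if "t \<ge> 0" for t
      proof -
        have "q (c *\<^sub>R x) \<le> m (c *\<^sub>R (x + t *\<^sub>R x0)) - c * t * m x0"
          using q_le[of "c * t" "c *\<^sub>R x"] c that by (simp add: algebra_simps)
        also have "\<dots> = c * ?f x t"
          using sublinear_scale[OF m, of c "x + t *\<^sub>R x0"] c by (simp add: algebra_simps)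
        finally show ?thesis using c by (simp add: field_simps)
      qed
      then have "q (c *\<^sub>R x) / c \<le> q x" by (rule q_ge)
      then show "q (c *\<^sub>R x) \<le> c * q x" using c by (simp add: field_simps)
    next
      have "q 0 \<le> 0" using q_le[of 0 0] sublinear_0[OF m] by simp
      moreover have "0 \<le> q 0"
        by (rule q_ge) (simp add: sublinear_scale[OF m])
      ultimately show "q 0 = 0" by simp
    qed
    show "q x \<le> m x" for x using q_le[of 0 x] by simp
    show "q (- x0) \<le> - m x0" using q_le[of 1 "-x0"] sublinear_0[OF m] by simp
  qed
qed

text \<open>The common bound keeps every infimum finite, since
  \<open>- p (- x) \<le> - q (- x) \<le> q x\<close>. Subadditivity needs a single member below both
  \<open>q\<close> and \<open>r\<close>, which is what the total order provides.\<close>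

lemma sublinear_Inf_chain:
  assumes C: "C \<noteq> {}" "\<And>q. q \<in> C \<Longrightarrow> sublinear q" "\<And>q x. q \<in> C \<Longrightarrow> q x \<le> p x"
    and chain: "\<And>q r. q \<in> C \<Longrightarrow> r \<in> C \<Longrightarrow> q \<le> r \<or> r \<le> q"
  shows "sublinear (\<lambda>x. INF q\<in>C. q x)" "\<And>q x. q \<in> C \<Longrightarrow> (INF q\<in>C. q x) \<le> q x"
proof -
  have lb: "- p (- x) \<le> q x" if "q \<in> C" for q x
    using sublinear_neg[OF C(2)[OF that], of x] C(3)[OF that, of "-x"] by simp
  show low: "(INF q\<in>C. q x) \<le> q x" if "q \<in> C" for q x
    by (rule cINF_lower) (use lb that in \<open>auto intro!: bdd_belowI2\<close>)
  have ge: "a \<le> (INF q\<in>C. q x)" if "\<And>q. q \<in> C \<Longrightarrow> a \<le> q x" for a x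
    by (rule cINF_greatest) (use that C in auto)
  show "sublinear (\<lambda>x. INF q\<in>C. q x)"
  proof (rule sublinearI)
    fix x y
    let ?i = "\<lambda>x. INF q\<in>C. q x"
    have "?i (x + y) - q x \<le> r y" if "q \<in> C" "r \<in> C" for q r
    proof -
      obtain s where s: "s \<in> C" "s \<le> q" "s \<le> r"
        using chain[OF \<open>q \<in> C\<close> \<open>r \<in> C\<close>] \<open>q \<in> C\<close> \<open>r \<in> C\<close> by (metis order_refl)
      have "?i (x + y) \<le> s (x + y)" using low s by blast
      also have "\<dots> \<le> s x + s y" using sublinear_add C s by blast
      also have "\<dots> \<le> q x + r y" using s by (simp add: le_fun_def add_mono)
      finally show ?thesis by simp
    qed
    then have "?i (x + y) - ?i y \<le> q x" if "q \<in> C" for q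
      using ge[of "?i (x + y) - q x" y] that by fastforce
    then show "?i (x + y) \<le> ?i x + ?i y"
      using ge[of "?i (x + y) - ?i y" x] by simp
  next
    fix c :: real and x assume c: "c > 0"
    have "(INF q\<in>C. q (c *\<^sub>R x)) / c \<le> q x" if "q \<in> C" for q
      using low[OF that, of "c *\<^sub>R x"] sublinear_scale[OF C(2)[OF that], of c x] c
      by (simp add: field_simps)
    then have "(INF q\<in>C. q (c *\<^sub>R x)) / c \<le> (INF q\<in>C. q x)" by (rule ge)
    then show "(INF q\<in>C. q (c *\<^sub>R x)) \<le> c * (INF q\<in>C. q x)" using c by (simp add: field_simps)
  next
    have "(\<lambda>q. q 0) ` C = {0}" using C(1) sublinear_0[OF C(2)] by force
    then show "(INF q\<in>C. q 0) = 0" by simp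
  qed
qed

text \<open>Minimal sublinear functionals turn out to be linear, so Zorn's lemma for the reversed
  pointwise order replaces the usual extension of partial linear functionals.\<close>

lemma minimal_sublinear:
  fixes p :: "'a::real_vector \<Rightarrow> real"
  assumes p: "sublinear p"
  obtains m where "sublinear m" "m \<le> p" "\<And>q. sublinear q \<Longrightarrow> q \<le> m \<Longrightarrow> q = m"
proof -
  let ?A = "{q. sublinear q \<and> q \<le> p}"
  let ?P = "\<lambda>q r :: 'a \<Rightarrow> real. r \<le> q"
  have "\<exists>m\<in>?A. \<forall>a\<in>?A. ?P m a \<longrightarrow> a = m"
  proof (rule predicate_Zorn)
    show "partial_order_on ?A (relation_of ?P ?A)"
      by (rule partial_order_on_relation_ofI) auto
    fix C assume C: "C \<in> Chains (relation_of ?P ?A)"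
    show "\<exists>u\<in>?A. \<forall>a\<in>C. u \<le> a"
    proof (cases "C = {}")
      case True
      then show ?thesis using p by auto
    next
      case False
      have sub: "C \<subseteq> ?A" and ch: "\<And>q r. q \<in> C \<Longrightarrow> r \<in> C \<Longrightarrow> q \<le> r \<or> r \<le> q"
        using C unfolding Chains_def relation_of_def by fastforce+
      let ?i = "\<lambda>x. INF q\<in>C. q x"
      have 1: "sublinear ?i" and 2: "\<And>q x. q \<in> C \<Longrightarrow> ?i x \<le> q x"
        using sublinear_Inf_chain[of C p] False sub ch by (auto simp: le_fun_def)
      obtain q where "q \<in> C" using False by blast
      then have "?i \<le> p" using 2 sub by (metis (mono_tags, lifting) le_fun_def mem_Collect_eq order_trans subsetD)
      then show ?thesis using 1 2 by (intro bexI[of _ ?i]) (auto simp: le_fun_def)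
    qed
  qed
  then show thesis using that by (metis (mono_tags, lifting) mem_Collect_eq order_trans)
qed

theorem hahn_banach_sublinear:
  fixes p :: "'a::real_vector \<Rightarrow> real"
  assumes p: "sublinear p"
  obtains F where "linear F" "\<And>x. F x \<le> p x" "F x0 = p x0"
proof -
  obtain q where q: "sublinear q" "\<And>x. q x \<le> p x" "q (- x0) \<le> - p x0"
    using sublinear_directional[OF p] by blast
  obtain m where m: "sublinear m" "m \<le> q" "\<And>r. sublinear r \<Longrightarrow> r \<le> m \<Longrightarrow> r = m"
    using minimal_sublinear[OF q(1)] by blast
  have neg: "m (- x) = - m x" for x
  proof -
    obtain r where "sublinear r" "\<And>y. r y \<le> m y" "r (- x) \<le> - m x"
      using sublinear_directional[OF m(1)] by blast
    then have "m (- x) \<le> - m x" using m(3) by (metis le_funI)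
    then show ?thesis using sublinear_neg[OF m(1), of x] by linarith
  qed
  show thesis
  proof
    show "linear m"
    proof (rule linearI)
      \<comment> \<open>The missing inequality is subadditivity for
        \<open>x = (x + y) + (- y)\<close>, combined with oddness.\<close>
      show "m (x + y) = m x + m y" for x y
        using sublinear_add[OF m(1), of x y] sublinear_add[OF m(1), of "x + y" "- y"] neg[of y]
        by simp
      show "m (c *\<^sub>R x) = c *\<^sub>R m x" for c x
      proof (cases "c \<ge> 0")
        case True
        then show ?thesis using sublinear_scale[OF m(1)] by simp
      next
        case False
        then have "m (- (c *\<^sub>R x)) = (- c) * m x"
          using sublinear_scale[OF m(1), of "- c" x] by simp
        then show ?thesis using neg[of "c *\<^sub>R x"] by simp
      qed
    qed
    show le: "m x \<le> p x" for x using m(2) q(2) by (meson le_funD order_trans)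
    show "m x0 = p x0" using neg[of x0] m(2) q(3) le[of x0] le_funD[OF m(2), of "-x0"] by simp
  qed
qed

section \<open>Bounded functionals: norming and separation\<close>

text \<open>A one-sided bound suffices because it applies to both \<open>x\<close> and
  \<open>- x\<close>. Three choices of \<open>p\<close> matter: the norm, the distance to a closed
  subspace and, on the dual space, the limit superior along a bounded sequence.\<close>

lemma hahn_banach_blinfun:
  fixes p :: "'a::real_normed_vector \<Rightarrow> real"
  assumes p: "sublinear p" and C: "\<And>x. p x \<le> C * norm x" "C \<ge> 0"
  obtains \<phi> :: "'a \<Rightarrow>\<^sub>L real"
    where "\<And>x. \<phi> x \<le> p x" "\<phi> x0 = p x0" "norm \<phi> \<le> C"
proof -
  obtain F where F: "linear F" "\<And>x. F x \<le> p x" "F x0 = p x0"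
    using hahn_banach_sublinear[OF p] by blast
  have b: "norm (F x) \<le> C * norm x" for x
  proof -
    have "F x \<le> C * norm x" "- F x \<le> C * norm x"
      using F(2)[of x] C(1)[of x] F(2)[of "-x"] C(1)[of "-x"] linear_neg[OF F(1), of x] by simp_all
    then show ?thesis by simp
  qed
  have bl: "bounded_linear F"
    using F(1) b by (intro bounded_linear_intro[where K = C]) (auto simp: linear_add linear_scale mult.commute)
  have "norm (Blinfun F) \<le> C"
    using b C(2) by (intro norm_blinfun_bound) (auto simp: bounded_linear_Blinfun_apply[OF bl])
  then show thesis
    using that[of "Blinfun F"] F by (simp add: bounded_linear_Blinfun_apply[OF bl])
qed

lemma norming_functional:
  fixes x :: "'a::real_normed_vector"
  obtains \<phi> :: "'a \<Rightarrow>\<^sub>L real" where "norm \<phi> \<le> 1" "\<phi> x = norm x"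
proof -
  have "sublinear (norm :: 'a \<Rightarrow> real)"
    by (rule sublinearI) (auto simp: norm_triangle_ineq)
  from hahn_banach_blinfun[OF this, of 1 x] that show thesis by auto
qed

text \<open>The distance to \<open>Y\<close> is sublinear because \<open>Y\<close> is a subspace,
  vanishes on \<open>Y\<close>, and is positive at \<open>x\<close> because \<open>Y\<close> is
  closed. A functional below it with equality at \<open>x\<close> separates.\<close>

lemma subspace_separation:
  fixes Y :: "'a::real_normed_vector set"
  assumes Y: "subspace Y" "closed Y" and x: "x \<notin> Y"
  obtains \<phi> :: "'a \<Rightarrow>\<^sub>L real" where "\<And>y. y \<in> Y \<Longrightarrow> \<phi> y = 0" "\<phi> x \<noteq> 0"
proof -
  let ?p = "\<lambda>z. infdist z Y"
  have ne: "Y \<noteq> {}" using subspace_0[OF Y(1)] by blast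
  have appr: "\<exists>y\<in>Y. dist z y < infdist z Y + e" if "e > 0" for z and e :: real
    using that ne cInf_lessD[of "dist z ` Y" "infdist z Y + e"]
    unfolding infdist_def by auto
  have sl: "sublinear ?p"
  proof (rule sublinearI)
    fix z w
    show "?p (z + w) \<le> ?p z + ?p w"
    proof (rule field_le_epsilon)
      fix e :: real assume "e > 0"
      then obtain y v where yv: "y \<in> Y" "v \<in> Y" "dist z y < ?p z + e/2" "dist w v < ?p w + e/2"
        using appr[of "e/2"] by (metis half_gt_zero)
      have "?p (z + w) \<le> dist (z + w) (y + v)"
        by (rule infdist_le) (use yv Y subspace_add in blast)
      also have "\<dots> \<le> dist z y + dist w v" by (rule dist_triangle_add)
      finally show "?p (z + w) \<le> ?p z + ?p w + e" using yv by simp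
    qed
  next
    fix c :: real and z assume c: "c > 0"
    show "?p (c *\<^sub>R z) \<le> c * ?p z"
    proof (rule field_le_epsilon)
      fix e :: real assume "e > 0"
      then obtain y where y: "y \<in> Y" "dist z y < ?p z + e / c"
        using appr[of "e / c"] c by (metis divide_pos_pos)
      have "?p (c *\<^sub>R z) \<le> dist (c *\<^sub>R z) (c *\<^sub>R y)"
        by (rule infdist_le) (use y Y subspace_scale in blast)
      also have "\<dots> = c * dist z y" using c by (simp add: dist_norm flip: scaleR_diff_right)
      also have "\<dots> \<le> c * ?p z + e" using y c by (simp add: field_simps)
      finally show "?p (c *\<^sub>R z) \<le> c * ?p z + e" .
    qed
  next
    show "?p 0 = 0" using subspace_0[OF Y(1)] by simp
  qed
  have bd: "?p z \<le> 1 * norm z" for z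
    using infdist_le[OF subspace_0[OF Y(1)], of z] by simp
  obtain \<phi> :: "'a \<Rightarrow>\<^sub>L real" where \<phi>: "\<And>z. \<phi> z \<le> ?p z" "\<phi> x = ?p x"
    using hahn_banach_blinfun[OF sl bd, of x] by auto
  show thesis
  proof
    show "\<phi> y = 0" if "y \<in> Y" for y
      using \<phi>(1)[of y] \<phi>(1)[of "-y"] that subspace_neg[OF Y(1) that] by (simp add: blinfun.minus_right)
    show "\<phi> x \<noteq> 0" using \<phi>(2) x Y(2) ne in_closed_iff_infdist_zero by auto
  qed
qed

section \<open>Weak sequential compactness\<close>

lemma tendsto_imp_weakly_converges:
  "u \<longlonglongrightarrow> l \<Longrightarrow> weakly_converges u l"
  unfolding weakly_converges_def by (auto intro!: tendsto_intros)

lemma weakly_converges_subseq: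
  "weakly_converges u l \<Longrightarrow> strict_mono r \<Longrightarrow> weakly_converges (\<lambda>n. u (r n)) l"
  unfolding weakly_converges_def using LIMSEQ_subseq_LIMSEQ by (fastforce simp: o_def)

lemma weakly_converges_add:
  "weakly_converges u a \<Longrightarrow> weakly_converges v b \<Longrightarrow> weakly_converges (\<lambda>n. u n + v n) (a + b)"
  unfolding weakly_converges_def by (auto simp: blinfun.add_right intro!: tendsto_add)

lemma weakly_converges_scaleR:
  "weakly_converges u a \<Longrightarrow> weakly_converges (\<lambda>n. c *\<^sub>R u n) (c *\<^sub>R a)"
  unfolding weakly_converges_def by (auto simp: blinfun.scaleR_right intro!: tendsto_mult_left)

lemma weakly_converges_unique:
  assumes "weakly_converges u a" "weakly_converges u b"
  shows "a = b"
proof -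
  obtain \<phi> :: "'a \<Rightarrow>\<^sub>L real" where \<phi>: "\<phi> (a - b) = norm (a - b)"
    using norming_functional by blast
  have "\<phi> a = \<phi> b"
    using assms LIMSEQ_unique unfolding weakly_converges_def by blast
  then show ?thesis using \<phi> by (simp add: blinfun.diff_right)
qed

text \<open>The argument treats one functional at a time, so no metric for the weak topology is
  involved. It upgrades compactness with a unique possible limit to convergence of the whole
  sequence.\<close>

lemma weakly_converges_if_subsubseq:
  assumes "\<And>r. strict_mono (r::nat\<Rightarrow>nat) \<Longrightarrow>
    \<exists>s. strict_mono (s::nat\<Rightarrow>nat) \<and> weakly_converges (\<lambda>n. u (r (s n))) l"
  shows "weakly_converges u l"
  unfolding weakly_converges_def
proof (rule allI, rule ccontr)
  fix \<phi> :: "'a \<Rightarrow>\<^sub>L real"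
  assume "\<not> (\<lambda>n. \<phi> (u n)) \<longlonglongrightarrow> \<phi> l"
  then obtain e where e: "e > 0" "\<And>N. \<exists>n\<ge>N. \<not> dist (\<phi> (u n)) (\<phi> l) < e"
    unfolding lim_sequentially by blast
  define S where "S = {n. \<not> dist (\<phi> (u n)) (\<phi> l) < e}"
  have "infinite S" unfolding S_def infinite_nat_iff_unbounded_le using e(2) by blast
  then obtain r :: "nat \<Rightarrow> nat" where r: "strict_mono r" "\<And>n. r n \<in> S"
    using infinite_enumerate by blast
  obtain s where s: "strict_mono (s::nat\<Rightarrow>nat)" "weakly_converges (\<lambda>n. u (r (s n))) l"
    using assms[OF r(1)] by blast
  then have "\<forall>\<^sub>F n in sequentially. dist (\<phi> (u (r (s n)))) (\<phi> l) < e"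
    unfolding weakly_converges_def using e(1) tendstoD by blast
  then show False using r(2) unfolding S_def by (simp add: eventually_sequentially) blast
qed

lemma weakly_converges_closed_subspace:
  assumes "weakly_converges u l" "\<And>n. u n \<in> Y" "subspace Y" "closed Y"
  shows "l \<in> Y"
proof (rule ccontr)
  assume "l \<notin> Y"
  then obtain \<phi> :: "'a \<Rightarrow>\<^sub>L real" where \<phi>: "\<And>y. y \<in> Y \<Longrightarrow> \<phi> y = 0" "\<phi> l \<noteq> 0"
    using subspace_separation assms by blast
  have "(\<lambda>n. \<phi> (u n)) \<longlonglongrightarrow> \<phi> l" using assms(1) unfolding weakly_converges_def by blast
  then show False using \<phi> assms(2) by (simp add: LIMSEQ_const_iff)
qed

lemma weakly_converges_norm_le:
  assumes "weakly_converges u l" "\<And>n. norm (u n) \<le> C"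
  shows "norm l \<le> C"
proof -
  obtain \<phi> :: "'a \<Rightarrow>\<^sub>L real" where \<phi>: "norm \<phi> \<le> 1" "\<phi> l = norm l"
    using norming_functional by blast
  have lim: "(\<lambda>n. \<phi> (u n)) \<longlonglongrightarrow> \<phi> l" using assms(1) unfolding weakly_converges_def by blast
  have "\<phi> (u n) \<le> C" for n
  proof -
    have "\<phi> (u n) \<le> norm \<phi> * norm (u n)" using norm_blinfun[of \<phi> "u n"] by simp
    also have "\<dots> \<le> 1 * norm (u n)" using \<phi>(1) by (intro mult_right_mono) auto
    finally show ?thesis using assms(2)[of n] by simp
  qed
  then show ?thesis using LIMSEQ_le_const2[OF lim] \<phi>(2) by auto
qed

section \<open>Separable subspaces and countable norming families\<close>

text \<open>Only rational multiples are adjoined, to stay countable; density of the rationals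
  restores real scalars in the closure. Invariance is stated for \<open>D\<close> and not for its
  closure, since no continuity of \<open>T\<close> is assumed here.\<close>

lemma countable_invariant_hull:
  fixes S :: "'a::real_normed_vector set" and T :: "'a \<Rightarrow> 'a"
  assumes S: "countable S"
  obtains D where "countable D" "S \<subseteq> D" "T ` D \<subseteq> D" "subspace (closure D)"
proof -
  define step where "step E = E \<union> T ` E \<union> (\<lambda>(x, y). x + y) ` (E \<times> E)
     \<union> (\<lambda>(q, x). q *\<^sub>R x) ` (\<rat> \<times> E)" for E
  define E where "E n = (step ^^ n) (insert 0 S)" for n
  define D where "D = (\<Union>n. E n)"
  have E_Suc: "E (Suc n) = step (E n)" for n unfolding E_def by simp
  have "countable (E n)" for n
  proof (induction n)
    case 0
    then show ?case using S by (simp add: E_def)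
  next
    case (Suc n)
    then show ?case unfolding E_Suc step_def
      by (intro countable_Un countable_image countable_SIGMA countable_rat)
  qed
  then have cD: "countable D" unfolding D_def by simp
  have sub: "insert 0 S \<subseteq> D" unfolding D_def using UN_upper[of 0 UNIV E] by (simp add: E_def)
  have mono: "E m \<subseteq> E n" if "m \<le> n" for m n
    using that by (rule lift_Suc_mono_le[rotated]) (auto simp: E_Suc step_def)
  have T: "T x \<in> D" if "x \<in> D" for x
  proof -
    obtain n where "x \<in> E n" using \<open>x \<in> D\<close> unfolding D_def by blast
    then have "T x \<in> E (Suc n)" unfolding E_Suc step_def by blast
    then show ?thesis unfolding D_def by blast
  qed
  have scale: "q *\<^sub>R x \<in> D" if "x \<in> D" "q \<in> \<rat>" for q x
  proof -
    obtain n where "x \<in> E n" using \<open>x \<in> D\<close> unfolding D_def by blast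
    then have "q *\<^sub>R x \<in> E (Suc n)" unfolding E_Suc step_def using that(2) by force
    then show ?thesis unfolding D_def by blast
  qed
  have add: "x + y \<in> D" if xy: "x \<in> D" "y \<in> D" for x y
  proof -
    obtain m n where "x \<in> E m" "y \<in> E n" using xy unfolding D_def by blast
    then have "x \<in> E (max m n)" "y \<in> E (max m n)"
      using mono by (meson max.cobounded1 max.cobounded2 subsetD)+
    then have "x + y \<in> E (Suc (max m n))" unfolding E_Suc step_def by force
    then show ?thesis unfolding D_def by blast
  qed
  have "subspace (closure D)"
    unfolding subspace_def
  proof (intro conjI ballI allI)
    show "0 \<in> closure D" using sub closure_subset by fast
  next
    fix x y assume "x \<in> closure D" "y \<in> closure D"
    then obtain u v where "\<forall>n. u n \<in> D" "u \<longlonglongrightarrow> x" "\<forall>n. v n \<in> D" "v \<longlonglongrightarrow> y"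
      unfolding closure_sequential by blast
    then show "x + y \<in> closure D"
      using add tendsto_add[of u x sequentially v y] unfolding closure_sequential
      by (intro exI[of _ "\<lambda>n. u n + v n"]) simp
  next
    fix c :: real and x assume "x \<in> closure D"
    then obtain u where u: "\<forall>n. u n \<in> D" "u \<longlonglongrightarrow> x"
      unfolding closure_sequential by blast
    have "c \<in> closure \<rat>" using Rats_closure_real by simp
    then obtain q where q: "\<forall>n. q n \<in> \<rat>" "q \<longlonglongrightarrow> c"
      unfolding closure_sequential by blast
    show "c *\<^sub>R x \<in> closure D"
      using scale u q tendsto_scaleR[of q c sequentially u x] unfolding closure_sequential
      by (intro exI[of _ "\<lambda>n. q n *\<^sub>R u n"]) simp
  qed
  then show thesis using that[of D] cD sub T by blast
qed

text \<open>One norming functional for each point of \<open>D\<close> is enough: if all of them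
  vanish at \<open>y\<close>, then \<open>norm d \<le> norm (d - y)\<close> for every
  \<open>d\<close> in \<open>D\<close>, and letting \<open>d\<close> tend to \<open>y\<close> forces
  \<open>y = 0\<close>.\<close>

lemma countable_norming_family:
  fixes D :: "'a::real_normed_vector set"
  assumes "countable D"
  obtains G :: "('a \<Rightarrow>\<^sub>L real) set"
    where "countable G" "\<And>g. g \<in> G \<Longrightarrow> norm g \<le> 1"
      "\<And>y. y \<in> closure D \<Longrightarrow> (\<And>g. g \<in> G \<Longrightarrow> g y = 0) \<Longrightarrow> y = 0"
proof -
  have "\<exists>\<phi> :: 'a \<Rightarrow>\<^sub>L real. norm \<phi> \<le> 1 \<and> blinfun_apply \<phi> x = norm x" for x
    using norming_functional[of x] by blast
  then obtain \<phi> :: "'a \<Rightarrow> ('a \<Rightarrow>\<^sub>L real)" where \<phi>: "\<And>x. norm (\<phi> x) \<le> 1" "\<And>x. blinfun_apply (\<phi> x) x = norm x"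
    by metis
  show thesis
  proof
    show "countable (\<phi> ` D)" using assms by simp
    show "norm g \<le> 1" if "g \<in> \<phi> ` D" for g using that \<phi> by blast
    fix y assume y: "y \<in> closure D" and z: "\<And>g. g \<in> \<phi> ` D \<Longrightarrow> g y = 0"
    obtain d where d: "\<forall>n. d n \<in> D" "d \<longlonglongrightarrow> y" 
      using y unfolding closure_sequential by blast
    have "norm (d n) \<le> norm (d n - y)" for n
    proof -
      have "norm (d n) = \<phi> (d n) (d n - y)" using \<phi> z d(1) by (simp add: blinfun.diff_right)
      also have "\<dots> \<le> norm (\<phi> (d n)) * norm (d n - y)"
        using norm_blinfun[of "\<phi> (d n)" "d n - y"] by simp
      also have "\<dots> \<le> 1 * norm (d n - y)" using \<phi>(1) by (intro mult_right_mono) auto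
      finally show ?thesis by simp
    qed
    moreover have "(\<lambda>n. norm (d n - y)) \<longlonglongrightarrow> 0"
      using d(2) by (simp add: LIM_zero tendsto_norm_zero)
    ultimately have "d \<longlonglongrightarrow> 0"
      by (intro Lim_null_comparison[where f = d]) auto
    then show "y = 0" using d(2) LIMSEQ_unique by blast
  qed
qed

section \<open>Limits superior and reflexivity\<close>

lemma reflexive_represent:
  fixes F :: "('a::real_normed_vector \<Rightarrow>\<^sub>L real) \<Rightarrow>\<^sub>L real"
  assumes "reflexive_space TYPE('a)"
  obtains x where "\<And>\<phi>. F \<phi> = blinfun_apply \<phi> x"
proof -
  obtain x where "F = bidual_embedding x"
    using assms unfolding reflexive_space_def surj_def by blast
  then show thesis using that by (simp add: bidual_embedding.rep_eq)
qed

text \<open>The library's \<open>limsup\<close> needs a complete lattice, so it is unavailable on \<open>real\<close>; the value is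
  meaningful only for bounded sequences.\<close>

definition rlimsup :: "(nat \<Rightarrow> real) \<Rightarrow> real" where
  "rlimsup a = (INF N. SUP n\<in>{N..}. a n)"

lemma
  fixes a b :: "nat \<Rightarrow> real"
  assumes a: "\<And>n. \<bar>a n\<bar> \<le> C"
  shows rlimsup_less: "rlimsup a < c \<Longrightarrow> \<forall>\<^sub>F n in sequentially. a n < c"
    and rlimsup_le: "(\<forall>\<^sub>F n in sequentially. a n \<le> c) \<Longrightarrow> rlimsup a \<le> c"
proof -
  have bd: "bdd_above (a ` {N..})" for N
    using a by (intro bdd_aboveI2[of _ _ C]) (auto simp: abs_le_iff)
  have lo: "- C \<le> (SUP n\<in>{N..}. a n)" for N
    using cSUP_upper[OF _ bd[of N], of N] a[of N] by (simp add: abs_le_iff)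
  then have bb: "bdd_below (range (\<lambda>N. SUP n\<in>{N..}. a n))"
    by (intro bdd_belowI2)
  show "\<forall>\<^sub>F n in sequentially. a n < c" if less: "rlimsup a < c"
  proof -
    obtain N where "(SUP n\<in>{N..}. a n) < c"
      using less cINF_less_iff[OF UNIV_not_empty bb, of c] unfolding rlimsup_def by fast
    moreover have "a n \<le> (SUP n\<in>{N..}. a n)" if "n \<ge> N" for n
      using that by (intro cSUP_upper bd) simp
    ultimately show ?thesis
      unfolding eventually_sequentially using order_le_less_trans by blast
  qed
  show "rlimsup a \<le> c" if ev: "\<forall>\<^sub>F n in sequentially. a n \<le> c"
  proof -
    obtain N where "\<And>n. n \<ge> N \<Longrightarrow> a n \<le> c" using ev unfolding eventually_sequentially by blast
    then have "(SUP n\<in>{N..}. a n) \<le> c" by (intro cSUP_least) auto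
    then show ?thesis unfolding rlimsup_def using cINF_lower[OF bb, of N] by simp
  qed
qed

lemma sublinear_rlimsup:
  fixes u :: "nat \<Rightarrow> 'a::real_normed_vector"
  assumes "\<And>n. norm (u n) \<le> C"
  shows "sublinear (\<lambda>\<phi> :: 'a \<Rightarrow>\<^sub>L real. rlimsup (\<lambda>n. \<phi> (u n)))"
    and "rlimsup (\<lambda>n. (\<phi> :: 'a \<Rightarrow>\<^sub>L real) (u n)) \<le> C * norm \<phi>"
proof -
  have b: "\<bar>\<phi> (u n)\<bar> \<le> norm \<phi> * C" for \<phi> :: "'a \<Rightarrow>\<^sub>L real" and n
    using order_trans[OF norm_blinfun[of \<phi> "u n"] mult_left_mono[OF assms norm_ge_zero[of \<phi>]]]
    by simp
  let ?p = "\<lambda>\<phi> :: 'a \<Rightarrow>\<^sub>L real. rlimsup (\<lambda>n. \<phi> (u n))"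
  show "?p \<phi> \<le> C * norm \<phi>"
    using b[of \<phi>] by (intro rlimsup_le[OF b]) (auto simp: abs_le_iff mult.commute)
  have ev: "\<forall>\<^sub>F n in sequentially. blinfun_apply \<phi> (u n) < ?p \<phi> + e" if "e > 0" for \<phi> and e :: real
    using rlimsup_less[OF b] that by simp
  show "sublinear ?p"
  proof (rule sublinearI)
    fix \<phi> \<psi> :: "'a \<Rightarrow>\<^sub>L real"
    show "?p (\<phi> + \<psi>) \<le> ?p \<phi> + ?p \<psi>"
    proof (rule field_le_epsilon)
      fix e :: real assume "e > 0"
      then have "\<forall>\<^sub>F n in sequentially. (\<phi> + \<psi>) (u n) \<le> ?p \<phi> + ?p \<psi> + e"
        using eventually_conj[OF ev[of "e/2" \<phi>] ev[of "e/2" \<psi>]]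
        by (auto simp: blinfun.add_left elim!: eventually_mono)
      then show "?p (\<phi> + \<psi>) \<le> ?p \<phi> + ?p \<psi> + e" by (rule rlimsup_le[OF b])
    qed
  next
    fix c :: real and \<phi> :: "'a \<Rightarrow>\<^sub>L real" assume c: "c > 0"
    show "?p (c *\<^sub>R \<phi>) \<le> c * ?p \<phi>"
    proof (rule field_le_epsilon)
      fix e :: real assume "e > 0"
      then have "\<forall>\<^sub>F n in sequentially. (c *\<^sub>R \<phi>) (u n) \<le> c * ?p \<phi> + e"
        using c by (intro eventually_mono[OF ev[of "e/c" \<phi>]])
          (auto simp: blinfun.scaleR_left field_simps)
      then show "?p (c *\<^sub>R \<phi>) \<le> c * ?p \<phi> + e" by (rule rlimsup_le[OF b])
    qed
  next
    show "?p 0 = 0" by (simp add: rlimsup_def)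
  qed
qed

text \<open>\<open>- rlimsup (\<lambda>n. - a n)\<close> is the limit inferior, so the hypotheses
  squeeze both limits onto \<open>l\<close>.\<close>

lemma rlimsup_tendsto:
  fixes a :: "nat \<Rightarrow> real"
  assumes b: "\<And>n. \<bar>a n\<bar> \<le> C" and "rlimsup a \<le> l" "rlimsup (\<lambda>n. - a n) \<le> - l"
  shows "a \<longlonglongrightarrow> l"
proof (rule order_tendstoI)
  fix c assume "c < l"
  then have "\<forall>\<^sub>F n in sequentially. - a n < - c"
    using assms by (intro rlimsup_less[where C = C]) auto
  then show "\<forall>\<^sub>F n in sequentially. c < a n" by simp
next
  fix c assume "l < c"
  then show "\<forall>\<^sub>F n in sequentially. a n < c"
    using assms by (intro rlimsup_less[where C = C]) auto
qed

text \<open>Functionals dominated by the limsup along the sequence are Banach limits; by reflexivity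
  each is evaluation at a point, and a countable family of functionals already determines
  this point.\<close>

theorem reflexive_weakly_seq_compact:
  fixes u :: "nat \<Rightarrow> 'a::real_normed_vector"
  assumes refl: "reflexive_space TYPE('a)" and C: "\<And>n. norm (u n) \<le> C"
  obtains l r where "strict_mono (r::nat\<Rightarrow>nat)" "weakly_converges (\<lambda>n. u (r n)) l"
proof -
  obtain D where D: "countable D" "range u \<subseteq> D" "subspace (closure D)"
    by (rule countable_invariant_hull[of "range u" id]) auto
  obtain G :: "('a \<Rightarrow>\<^sub>L real) set" where G: "countable G" "\<And>g. g \<in> G \<Longrightarrow> norm g \<le> 1"
      "\<And>y. y \<in> closure D \<Longrightarrow> (\<And>g. g \<in> G \<Longrightarrow> g y = 0) \<Longrightarrow> y = 0"
    by (rule countable_norming_family[OF D(1)]) blast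
  have C0: "C \<ge> 0" using C[of 0] norm_ge_zero order_trans by blast
  have "norm (g (u n)) \<le> C" if "g \<in> G" for g n
    using norm_blinfun[of g "u n"] mult_mono[OF G(2)[OF that] C[of n]] C0 by simp
  \<comment> \<open>Diagonal extraction yields convergence only on the countable family
    \<open>G\<close>; the other functionals are reached through uniqueness of the represented
    point.\<close>
  then obtain r where r: "strict_mono (r::nat\<Rightarrow>nat)"
      "\<And>g. g \<in> G \<Longrightarrow> \<exists>l. (\<lambda>n. g (u (r n))) \<longlonglongrightarrow> l"
    using function_convergent_subsequence[of G "\<lambda>n g. blinfun_apply g (u n)" C] G(1) by metis
  define v where "v n = u (r n)" for n
  have v: "norm (v n) \<le> C" "v n \<in> closure D" for n
    using C D(2) closure_subset by (auto simp: v_def)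
  define p where "p \<phi> = rlimsup (\<lambda>n. blinfun_apply \<phi> (v n))" for \<phi> :: "'a \<Rightarrow>\<^sub>L real"
  have bound: "\<bar>\<phi> (v n)\<bar> \<le> norm \<phi> * C" for \<phi> :: "'a \<Rightarrow>\<^sub>L real" and n
    using order_trans[OF norm_blinfun[of \<phi> "v n"] mult_left_mono[OF v(1) norm_ge_zero[of \<phi>]]]
    by simp
  have p: "sublinear p" "p \<phi> \<le> C * norm \<phi>" for \<phi>
    using sublinear_rlimsup[of v C] v unfolding p_def by auto
  have p_lim: "p \<phi> \<le> c" if "(\<lambda>n. blinfun_apply \<phi> (v n)) \<longlonglongrightarrow> c" for \<phi> c
  proof (rule field_le_epsilon)
    fix e :: real assume "e > 0"
    then have "\<forall>\<^sub>F n in sequentially. \<phi> (v n) < c + e" using that by (simp add: order_tendstoD)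
    then show "p \<phi> \<le> c + e" unfolding p_def
      by (intro rlimsup_le[OF bound]) (rule eventually_mono, assumption, simp)
  qed
  \<comment> \<open>Equality at a prescribed \<open>\<phi>0\<close> matters: once the represented
    point is known to be unique, it forces \<open>p\<close> to be evaluation at that point.\<close>
  have ex: "\<exists>x. (\<forall>\<phi>. blinfun_apply \<phi> x \<le> p \<phi>) \<and> blinfun_apply \<phi>0 x = p \<phi>0" for \<phi>0
  proof -
    obtain F :: "('a \<Rightarrow>\<^sub>L real) \<Rightarrow>\<^sub>L real" where F: "\<And>\<phi>. F \<phi> \<le> p \<phi>" "F \<phi>0 = p \<phi>0"
      by (rule hahn_banach_blinfun[OF p C0, of \<phi>0]) blast
    obtain x where "\<And>\<phi>. F \<phi> = blinfun_apply \<phi> x" using reflexive_represent[OF refl] by blast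
    then show ?thesis using F by (intro exI[of _ x]) simp
  qed
  have eq_lim: "blinfun_apply \<phi> x = c" if "\<forall>\<phi>. blinfun_apply \<phi> x \<le> p \<phi>" "(\<lambda>n. blinfun_apply \<phi> (v n)) \<longlonglongrightarrow> c"
    for \<phi> :: "'a \<Rightarrow>\<^sub>L real" and x c
  proof -
    have "(\<lambda>n. blinfun_apply (- \<phi>) (v n)) \<longlonglongrightarrow> - c"
      using that(2) by (simp add: blinfun.minus_left tendsto_minus)
    then have "p (- \<phi>) \<le> - c" by (rule p_lim)
    moreover have "p \<phi> \<le> c" using that(2) by (rule p_lim)
    ultimately show ?thesis
      using spec[OF that(1), of \<phi>] spec[OF that(1), of "- \<phi>"] by (simp add: blinfun.minus_left)
  qed
  \<comment> \<open>A functional vanishing on \<open>closure D\<close> tends to \<open>0\<close>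
    along \<open>v\<close>, so by \<open>eq_lim\<close> it vanishes at \<open>x\<close> too and
    cannot separate \<open>x\<close> from the subspace.\<close>
  have inD: "x \<in> closure D" if x: "\<forall>\<phi>. blinfun_apply \<phi> x \<le> p \<phi>" for x
  proof (rule ccontr)
    assume "x \<notin> closure D"
    then obtain \<phi> :: "'a \<Rightarrow>\<^sub>L real" where "\<And>y. y \<in> closure D \<Longrightarrow> \<phi> y = 0" "\<phi> x \<noteq> 0"
      using subspace_separation[OF D(3) closed_closure] by blast
    then show False using eq_lim[OF x, of \<phi> 0] v by simp
  qed
  have uniq: "x = y" if x: "\<forall>\<phi>. blinfun_apply \<phi> x \<le> p \<phi>" and y: "\<forall>\<phi>. blinfun_apply \<phi> y \<le> p \<phi>" for x y
  proof -
    have "g (x - y) = 0" if g: "g \<in> G" for g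
    proof -
      obtain c where "(\<lambda>n. g (v n)) \<longlonglongrightarrow> c" using r(2)[OF g] unfolding v_def by blast
      then show ?thesis using eq_lim x y by (simp add: blinfun.diff_right)
    qed
    moreover have "x - y \<in> closure D" using inD x y D(3) subspace_diff by blast
    ultimately show ?thesis using G(3)[of "x - y"] by simp
  qed
  obtain l where l: "\<forall>\<phi>. blinfun_apply \<phi> l \<le> p \<phi>" using ex by blast
  \<comment> \<open>So \<open>p\<close> is linear, and its values at \<open>\<phi>\<close> and
    \<open>- \<phi>\<close> make limit superior and limit inferior coincide.\<close>
  have pl: "p \<phi> = blinfun_apply \<phi> l" for \<phi>
  proof -
    obtain x where x: "\<forall>\<psi>. blinfun_apply \<psi> x \<le> p \<psi>" "\<phi> x = p \<phi>" using ex[of \<phi>] by blast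
    then show ?thesis using uniq[OF x(1) l] by simp
  qed
  have "(\<lambda>n. blinfun_apply \<phi> (v n)) \<longlonglongrightarrow> \<phi> l"
    for \<phi> :: "'a \<Rightarrow>\<^sub>L real"
    using pl[of \<phi>] pl[of "- \<phi>"] unfolding p_def
    by (intro rlimsup_tendsto[OF bound]) (auto simp: blinfun.minus_left)
  then have "weakly_converges v l" unfolding weakly_converges_def by blast
  then show thesis using that r(1) unfolding v_def by blast
qed

section \<open>Fixed points\<close>

text \<open>The dimension will be the size of a finite net, hence a variable, so points are
  functions on \<open>nat\<close> of which only the first \<open>n\<close> coordinates count. Kuhn's
  combinatorial lemma supplies the small cells, and the continuity hypothesis is sequential to match
  weak sequential continuity.\<close>

theorem brouwer_nat_cube:
  fixes G :: "(nat \<Rightarrow> real) \<Rightarrow> nat \<Rightarrow> real"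
  assumes range: "\<And>x i. (\<And>j. x j \<in> {0..1}) \<Longrightarrow> i < n \<Longrightarrow> G x i \<in> {0..1}"
    and cont: "\<And>u x i. (\<And>k j. u k j \<in> {0..1}) \<Longrightarrow> (\<And>j. j < n \<Longrightarrow> (\<lambda>k. u k j) \<longlonglongrightarrow> x j)
      \<Longrightarrow> (\<And>j. x j \<in> {0..1}) \<Longrightarrow> i < n \<Longrightarrow> (\<lambda>k. G (u k) i) \<longlonglongrightarrow> G x i"
  obtains x where "\<And>j. x j \<in> {0..1}" "\<And>i. i < n \<Longrightarrow> G x i = x i"
proof -
  \<comment> \<open>The grid point \<open>q / p\<close>. The cap at \<open>1\<close> keeps every
    coordinate in the unit interval, including those from \<open>n\<close> on, which Kuhn's lemma
    leaves unrestricted.\<close>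
  define g where "g p q = (\<lambda>i. min 1 (real (q i) / real p))" for p :: nat and q :: "nat \<Rightarrow> nat"
  have g01: "g p q i \<in> {0..1}" for p q i unfolding g_def by simp
  \<comment> \<open>Label \<open>0\<close> means that \<open>G\<close> does not lower coordinate
    \<open>i\<close>. Kuhn's lemma wants label \<open>1\<close> on the face \<open>q i = p\<close>;
    there the coordinate of the grid point is \<open>1\<close>, so \<open>G\<close> cannot raise
    it.\<close>
  define label where "label p q i = (if g p q i \<le> G (g p q) i \<and> q i \<noteq> p then 0 else 1 :: nat)"
    for p q i
  have cell: "\<exists>q. \<forall>i<n. \<exists>r s. (\<forall>j<n. q j \<le> r j \<and> r j \<le> q j + 1 \<and> q j \<le> s j \<and> s j \<le> q j + 1)
      \<and> g p r i \<le> G (g p r) i \<and> G (g p s) i \<le> g p s i" if p: "p > 0" for p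
  proof -
    have 0: "label p x i = 0" if "i < n" "x i = 0" for x i
      using range[of "g p x" i, OF g01 that(1)] that p unfolding label_def g_def by auto
    have l: "g p x i \<le> G (g p x) i" if "label p x i = 0" for x i
      using that unfolding label_def by (auto split: if_splits)
    have u: "G (g p x) i \<le> g p x i" if "label p x i \<noteq> 0" "i < n" for x i
    proof (cases "x i = p")
      case True
      then have "g p x i = 1" using p unfolding g_def by simp
      then show ?thesis using range[of "g p x" i, OF g01 \<open>i < n\<close>] by simp
    next
      case False
      then show ?thesis using that unfolding label_def by (auto split: if_splits)
    qed
    obtain q where q: "\<forall>i<n. \<exists>r s. (\<forall>j<n. q j \<le> r j \<and> r j \<le> q j + 1) \<and>
        (\<forall>j<n. q j \<le> s j \<and> s j \<le> q j + 1) \<and> label p r i \<noteq> label p s i"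
    proof (rule kuhn_lemma[of p n "label p"])
      show "0 < p" by fact
      show "\<forall>x. (\<forall>i<n. x i \<le> p) \<longrightarrow> (\<forall>i<n. label p x i = 0 \<or> label p x i = 1)"
        unfolding label_def by simp
      show "\<forall>x. (\<forall>i<n. x i \<le> p) \<longrightarrow> (\<forall>i<n. x i = 0 \<longrightarrow> label p x i = 0)" using 0 by blast
      show "\<forall>x. (\<forall>i<n. x i \<le> p) \<longrightarrow> (\<forall>i<n. x i = p \<longrightarrow> label p x i = 1)"
        unfolding label_def by simp
    qed blast
    show ?thesis
    proof (rule exI[of _ q], intro allI impI)
      fix i assume i: "i < n"
      then obtain r s where rs: "\<forall>j<n. q j \<le> r j \<and> r j \<le> q j + 1"
          "\<forall>j<n. q j \<le> s j \<and> s j \<le> q j + 1" "label p r i \<noteq> label p s i"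
        using q by blast
      show "\<exists>r s. (\<forall>j<n. q j \<le> r j \<and> r j \<le> q j + 1 \<and> q j \<le> s j \<and> s j \<le> q j + 1)
          \<and> g p r i \<le> G (g p r) i \<and> G (g p s) i \<le> g p s i"
      proof (cases "label p r i = 0")
        case True
        then have "label p s i \<noteq> 0" using rs(3) by simp
        then show ?thesis using True l u i rs by (intro exI[of _ r] exI[of _ s]) simp
      next
        case False
        then have "label p s i = 0" using rs(3) unfolding label_def by (auto split: if_splits)
        then show ?thesis using False l u i rs by (intro exI[of _ s] exI[of _ r]) simp
      qed
    qed
  qed
  define good where "good m q i r s \<longleftrightarrow>
      (\<forall>j<n. q j \<le> r j \<and> r j \<le> q j + 1 \<and> q j \<le> s j \<and> s j \<le> q j + 1)
      \<and> g (Suc m) r i \<le> G (g (Suc m) r) i \<and> G (g (Suc m) s) i \<le> g (Suc m) s i"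
    for m q i r s
  have "\<exists>q. \<forall>i<n. \<exists>r s. good m q i r s" for m
    unfolding good_def by (rule cell) simp
  then obtain q where "\<And>m. \<forall>i<n. \<exists>r s. good m (q m) i r s" by metis
  then obtain r s where good: "\<And>m i. i < n \<Longrightarrow> good m (q m) i (r m i) (s m i)" by metis
  have rs: "q m j \<le> r m i j \<and> r m i j \<le> q m j + 1 \<and> q m j \<le> s m i j \<and> s m i j \<le> q m j + 1"
    if "i < n" "j < n" for m i j
    using good[OF that(1)] that(2) unfolding good_def by blast
  have r: "g (Suc m) (r m i) i \<le> G (g (Suc m) (r m i)) i"
    and s: "G (g (Suc m) (s m i)) i \<le> g (Suc m) (s m i) i" if "i < n" for m i
    using good[OF that] unfolding good_def by blast+
  have "norm (g (Suc m) (q m) j) \<le> 1" for m j using g01[of "Suc m" "q m" j] by simp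
  then obtain k where k: "strict_mono (k::nat\<Rightarrow>nat)"
      "\<And>j. j \<in> UNIV \<Longrightarrow> \<exists>l. (\<lambda>m. g (Suc (k m)) (q (k m)) j) \<longlonglongrightarrow> l"
    by (rule function_convergent_subsequence[of UNIV "\<lambda>m. g (Suc m) (q m)" 1, OF countableI_type])
      (rule that; simp)
  from k(2)[OF UNIV_I] obtain x where x: "\<And>j. (\<lambda>m. g (Suc (k m)) (q (k m)) j) \<longlonglongrightarrow> x j" by metis
  have x01: "x j \<in> {0..1}" for j
    using closed_sequentially[OF closed_atLeastAtMost _ x[of j]] g01 by blast
  have min_diff: "\<bar>min 1 a - min 1 b\<bar> \<le> \<bar>a - b\<bar>" for a b :: real by (simp add: min_def)
  \<comment> \<open>Capping does not increase distances, so any point of the cell differs from its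
    base corner by at most the mesh width in each coordinate and has the same limit.\<close>
  have conv: "(\<lambda>m. g (Suc (k m)) (t (k m)) j) \<longlonglongrightarrow> x j"
    if t: "\<And>m. q m j \<le> t m j \<and> t m j \<le> q m j + 1" for t j
  proof (rule Lim_transform[OF x])
    have "\<bar>g (Suc (k m)) (t (k m)) j - g (Suc (k m)) (q (k m)) j\<bar> \<le> 1 / real (Suc m)" for m
    proof -
      have "\<bar>g (Suc (k m)) (t (k m)) j - g (Suc (k m)) (q (k m)) j\<bar>
          \<le> \<bar>real (t (k m) j) / real (Suc (k m)) - real (q (k m) j) / real (Suc (k m))\<bar>"
        unfolding g_def by (rule min_diff)
      also have "\<dots> = \<bar>real (t (k m) j) - real (q (k m) j)\<bar> / real (Suc (k m))"
        unfolding diff_divide_distrib[symmetric] abs_divide by (simp only: abs_of_nat)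
      also have "\<dots> \<le> 1 / real (Suc (k m))"
      proof (rule divide_right_mono)
        show "\<bar>real (t (k m) j) - real (q (k m) j)\<bar> \<le> 1" using t[of "k m"] by linarith
      qed (rule of_nat_0_le_iff)
      also have "\<dots> \<le> 1 / real (Suc m)"
        using seq_suble[OF k(1), of m] by (intro divide_left_mono) simp_all
      finally show ?thesis .
    qed
    then have "\<forall>\<^sub>F m in sequentially. norm (g (Suc (k m)) (t (k m)) j - g (Suc (k m)) (q (k m)) j)
        \<le> 1 / real (Suc m)"
      by simp
    then show "(\<lambda>m. g (Suc (k m)) (t (k m)) j - g (Suc (k m)) (q (k m)) j) \<longlonglongrightarrow> 0"
      by (rule Lim_null_comparison) (rule LIMSEQ_Suc[OF lim_1_over_n])
  qed
  show thesis
  proof (rule that[OF x01])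
    fix i assume i: "i < n"
    \<comment> \<open>The points \<open>r\<close>, where coordinate \<open>i\<close> is not lowered,
      and \<open>s\<close>, where it is not raised, share the limit \<open>x\<close>, so both
      inequalities hold there.\<close>
    have r_lim: "(\<lambda>m. g (Suc (k m)) (r (k m) i) j) \<longlonglongrightarrow> x j"
      and s_lim: "(\<lambda>m. g (Suc (k m)) (s (k m) i) j) \<longlonglongrightarrow> x j" if "j < n" for j
      using rs[OF i that] by (rule_tac conv; simp)+
    have "(\<lambda>m. G (g (Suc (k m)) (r (k m) i)) i) \<longlonglongrightarrow> G x i"
      by (rule cont[OF g01 r_lim x01 i])
    from LIMSEQ_le[OF r_lim[OF i] this] have "x i \<le> G x i" using r[OF i] by blast
    moreover have "(\<lambda>m. G (g (Suc (k m)) (s (k m) i)) i) \<longlonglongrightarrow> G x i"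
      by (rule cont[OF g01 s_lim x01 i])
    from LIMSEQ_le[OF this s_lim[OF i]] have "G x i \<le> x i" using s[OF i] by blast
    ultimately show "G x i = x i" by simp
  qed
qed

section \<open>Schauder approximation for finitely many functionals\<close>

text \<open>The missing weight \<open>1 - sum c I\<close> is placed on the origin.\<close>

lemma convex_sum_le_1:
  fixes x :: "'i \<Rightarrow> 'a::real_vector"
  assumes K: "convex K" "0 \<in> K" and I: "finite I" "\<And>i. i \<in> I \<Longrightarrow> x i \<in> K"
    and c: "\<And>i. i \<in> I \<Longrightarrow> c i \<ge> 0" "sum c I \<le> 1"
  shows "(\<Sum>i\<in>I. c i *\<^sub>R x i) \<in> K"
proof (cases "sum c I = 0")
  case True
  then have "c i = 0" if "i \<in> I" for i using sum_nonneg_eq_0_iff[OF I(1)] c(1) that by blast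
  then show ?thesis using K(2) by simp
next
  case False
  then have pos: "sum c I > 0" using sum_nonneg[of I c] c(1) by force
  let ?y = "\<Sum>i\<in>I. (c i / sum c I) *\<^sub>R x i"
  have "?y \<in> K"
    by (rule convex_sum[OF I(1) K(1)])
      (use pos c I in \<open>simp_all add: sum_divide_distrib[symmetric]\<close>)
  then have "sum c I *\<^sub>R ?y + (1 - sum c I) *\<^sub>R 0 \<in> K"
    using convexD[OF K(1) _ K(2), of ?y "sum c I" "1 - sum c I"] pos c by simp
  moreover have "sum c I *\<^sub>R ?y = (\<Sum>i\<in>I. c i *\<^sub>R x i)"
    using pos by (simp add: scaleR_sum_right)
  ultimately show ?thesis by simp
qed

text \<open>This stands in for compactness of \<open>K\<close>: finitely many functionals map a
  norm-bounded set into a bounded box of a finite-dimensional space, where total boundedness is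
  automatic.\<close>

lemma finite_functional_net:
  fixes g :: "nat \<Rightarrow> ('a::real_normed_vector \<Rightarrow>\<^sub>L real)"
  assumes C: "\<And>x. x \<in> K \<Longrightarrow> norm x \<le> C" and d: "d > 0"
  obtains F where "finite F" "F \<subseteq> K"
    "\<And>y. y \<in> K \<Longrightarrow> \<exists>x\<in>F. \<forall>j<n. \<bar>blinfun_apply (g j) (y - x)\<bar> < d"
proof -
  \<comment> \<open>rounding the values of the functionals to multiples of \<open>d\<close> leaves finitely many classes\<close>
  define f where "f y = restrict (\<lambda>j. \<lfloor>blinfun_apply (g j) y / d\<rfloor>) {..<n}" for y
  have "f ` K \<subseteq> PiE {..<n} (\<lambda>j. {\<lfloor>- (norm (g j) * C / d)\<rfloor>..\<lfloor>norm (g j) * C / d\<rfloor>})"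
  proof (rule image_subsetI)
    fix y assume y: "y \<in> K"
    have "\<bar>blinfun_apply (g j) y\<bar> \<le> norm (g j) * C" for j
      using order_trans[OF norm_blinfun[of "g j" y] mult_left_mono[OF C[OF y] norm_ge_zero]] by simp
    then have "\<bar>blinfun_apply (g j) y / d\<bar> \<le> norm (g j) * C / d" for j
      using d by (simp add: abs_divide divide_right_mono)
    then have "- (norm (g j) * C / d) \<le> blinfun_apply (g j) y / d"
        "blinfun_apply (g j) y / d \<le> norm (g j) * C / d" for j
      unfolding abs_le_iff by (simp_all only: minus_le_iff)
    then show "f y \<in> PiE {..<n} (\<lambda>j. {\<lfloor>- (norm (g j) * C / d)\<rfloor>..\<lfloor>norm (g j) * C / d\<rfloor>})"
      unfolding f_def by (simp add: floor_mono)
  qed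
  then have "finite (f ` K)" by (rule finite_subset) (simp add: finite_PiE)
  then obtain F where F: "F \<subseteq> K" "finite F" "f ` K = f ` F"
    using finite_subset_image[of "f ` K" f K] by blast
  show thesis
  proof (rule that[OF F(2,1)])
    fix y assume "y \<in> K"
    then obtain x where x: "x \<in> F" "f y = f x" using F(3) by blast
    have "\<bar>blinfun_apply (g j) (y - x)\<bar> < d" if "j < n" for j
    proof -
      have "\<lfloor>blinfun_apply (g j) y / d\<rfloor> = \<lfloor>blinfun_apply (g j) x / d\<rfloor>"
        using fun_cong[OF x(2), of j] that by (simp add: f_def)
      then have "\<bar>blinfun_apply (g j) y / d - blinfun_apply (g j) x / d\<bar> < 1" by linarith
      then have "\<bar>(blinfun_apply (g j) y - blinfun_apply (g j) x) / d\<bar> < 1"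
        by (simp only: diff_divide_distrib)
      then show ?thesis using d by (simp add: abs_divide blinfun.diff_right)
    qed
    then show "\<exists>x\<in>F. \<forall>j<n. \<bar>blinfun_apply (g j) (y - x)\<bar> < d" using x(1) by blast
  qed
qed

text \<open>Convergent coordinates give norm convergent points in the hull of the net, and the
  weights see \<open>T\<close> only through functionals. Continuity of \<open>T\<close> from the
  norm to the weak topology is therefore enough.\<close>

lemma approximate_fixed_point:
  fixes K :: "'a::real_normed_vector set" and g :: "nat \<Rightarrow> ('a \<Rightarrow>\<^sub>L real)"
  assumes K: "convex K" "0 \<in> K" and C: "\<And>x. x \<in> K \<Longrightarrow> norm x \<le> C"
    and T: "\<And>x. x \<in> K \<Longrightarrow> T x \<in> K"
    and cont: "\<And>u x. (\<And>k. u k \<in> K) \<Longrightarrow> x \<in> K \<Longrightarrow> u \<longlonglongrightarrow> x \<Longrightarrow> weakly_converges (\<lambda>k. T (u k)) (T x)"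
    and d: "d > 0"
  obtains x where "x \<in> K" "\<forall>j<n. \<bar>blinfun_apply (g j) (T x - x)\<bar> \<le> d"
proof -
  obtain F where F: "finite F" "F \<subseteq> K"
      "\<And>y. y \<in> K \<Longrightarrow> \<exists>x\<in>F. \<forall>j<n. \<bar>blinfun_apply (g j) (y - x)\<bar> < d"
    by (rule finite_functional_net[of K C d n g, OF C d]) blast+
  define N where "N = card F"
  obtain xs where "bij_betw xs {0..<card F} F" using ex_bij_betw_nat_finite[OF F(1)] by blast
  then have xs: "F = xs ` {..<N}" unfolding N_def bij_betw_def atLeast0LessThan by blast
  \<comment> \<open>The Schauder projection onto the convex hull of the net, with barycentric coordinates replaced
    by a parametrisation \<open>p\<close> over the whole cube; fixed points have coordinate sum \<open>1\<close>.\<close>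
  define bump where "bump i y = (\<Prod>j<n. max 0 (d - \<bar>blinfun_apply (g j) (y - xs i)\<bar>))" for i y
  define total where "total y = (\<Sum>i<N. bump i y)" for y
  define p where "p t = (\<Sum>i<N. (t i / max 1 (\<Sum>l<N. t l)) *\<^sub>R xs i)" for t :: "nat \<Rightarrow> real"
  have bump0: "bump i y \<ge> 0" for i y unfolding bump_def by (intro prod_nonneg) simp
  have total_pos: "total y > 0" if y: "y \<in> K" for y
  proof -
    obtain i where i: "i < N" "\<forall>j<n. \<bar>blinfun_apply (g j) (y - xs i)\<bar> < d"
      using F(3)[OF y] unfolding xs by blast
    then have "bump i y > 0" unfolding bump_def by (intro prod_pos) simp
    then show ?thesis unfolding total_def using i(1) bump0
      by (intro sum_pos2[where i = i]) auto
  qed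
  have pK: "p t \<in> K" if t: "\<And>i. t i \<in> {0..1}" for t
    unfolding p_def
  proof (rule convex_sum_le_1[OF K])
    show "xs i \<in> K" if "i \<in> {..<N}" for i using that F(2) xs by blast
    show "0 \<le> t i / max 1 (\<Sum>l<N. t l)" for i using t[of i] by simp
    show "(\<Sum>i<N. t i / max 1 (\<Sum>l<N. t l)) \<le> 1"
      unfolding sum_divide_distrib[symmetric] by (simp add: divide_le_eq)
  qed simp
  have bump_lim: "(\<lambda>k. bump i (v k)) \<longlonglongrightarrow> bump i y" if "weakly_converges v y" for v y i
  proof -
    have "(\<lambda>k. blinfun_apply (g j) (v k)) \<longlonglongrightarrow> blinfun_apply (g j) y" for j
      using that unfolding weakly_converges_def by blast
    then show ?thesis unfolding bump_def blinfun.diff_right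
      by (intro tendsto_prod tendsto_max tendsto_const tendsto_diff tendsto_rabs)
  qed
  define G where "G t i = bump i (T (p t)) / total (T (p t))" for t i
  obtain t where t01: "\<And>j. t j \<in> {0..1}" and t: "\<And>i. i < N \<Longrightarrow> G t i = t i"
  proof (rule brouwer_nat_cube[of N G])
    fix t :: "nat \<Rightarrow> real" and i
    assume t: "\<And>j. t j \<in> {0..1}" and i: "i < N"
    have pos: "total (T (p t)) > 0" by (intro total_pos T pK t)
    have "bump i (T (p t)) \<le> total (T (p t))"
      unfolding total_def using i bump0 by (intro member_le_sum) auto
    then show "G t i \<in> {0..1}"
      unfolding G_def using pos bump0[of i "T (p t)"] by (simp add: divide_le_eq)
  next
    fix u :: "nat \<Rightarrow> nat \<Rightarrow> real" and t i
    assume u: "\<And>k j. u k j \<in> {0..1}" "\<And>j. j < N \<Longrightarrow> (\<lambda>k. u k j) \<longlonglongrightarrow> t j"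
      and t: "\<And>j. t j \<in> {0..1}" and i: "i < N"
    have pos: "total (T (p t)) > 0" by (intro total_pos T pK t)
    have "(\<lambda>k. p (u k)) \<longlonglongrightarrow> p t"
      unfolding p_def using u(2)
      by (intro tendsto_sum tendsto_scaleR tendsto_divide tendsto_max tendsto_const) auto
    then have w: "weakly_converges (\<lambda>k. T (p (u k))) (T (p t))"
      by (intro cont pK u(1) t)
    then show "(\<lambda>k. G (u k) i) \<longlonglongrightarrow> G t i"
      unfolding G_def total_def using pos[unfolded total_def]
      by (intro tendsto_divide tendsto_sum bump_lim) simp_all
  qed blast
  let ?x = "p t" and ?y = "T (p t)"
  have xK: "?x \<in> K" by (rule pK[OF t01])
  have tot: "total ?y > 0" by (rule total_pos[OF T[OF xK]])
  have "(\<Sum>i<N. t i) = (\<Sum>i<N. bump i ?y / total ?y)"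
    using t unfolding G_def by (intro sum.cong) simp_all
  also have "\<dots> = 1" using tot unfolding sum_divide_distrib[symmetric] by (simp add: total_def)
  finally have t1: "(\<Sum>i<N. t i) = 1" .
  \<comment> \<open>A net point at distance more than \<open>d\<close> in some functional carries
    weight zero, so every term of the weighted average is controlled.\<close>
  have small: "\<bar>t i * blinfun_apply (g j) (?y - xs i)\<bar> \<le> t i * d" if i: "i < N" and j: "j < n" for i j
  proof (cases "\<bar>blinfun_apply (g j) (?y - xs i)\<bar> \<le> d")
    case True
    then show ?thesis using t01[of i] by (simp add: abs_mult mult_left_mono)
  next
    case False
    then have "bump i ?y = 0" unfolding bump_def using j by (intro prod_zero bexI[of _ j]) auto
    then have "t i = 0" using t[OF i] unfolding G_def by simp
    then show ?thesis by simp
  qed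
  show thesis
  proof (rule that[OF xK], intro allI impI)
    fix j assume j: "j < n"
    have "?x = (\<Sum>i<N. t i *\<^sub>R xs i)" unfolding p_def t1 by simp
    moreover have "?y = (\<Sum>i<N. t i *\<^sub>R ?y)" unfolding scaleR_sum_left[symmetric] t1 by simp
    ultimately have "?y - ?x = (\<Sum>i<N. t i *\<^sub>R (?y - xs i))"
      by (simp add: scaleR_diff_right sum_subtractf)
    then have "\<bar>blinfun_apply (g j) (?y - ?x)\<bar> = \<bar>\<Sum>i<N. t i * blinfun_apply (g j) (?y - xs i)\<bar>"
      by (simp add: blinfun.sum_right blinfun.scaleR_right)
    also have "\<dots> \<le> (\<Sum>i<N. t i * d)"
      using small[OF _ j] by (intro order_trans[OF sum_abs] sum_mono) simp
    also have "\<dots> = d" unfolding sum_distrib_right[symmetric] t1 by simp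
    finally show "\<bar>blinfun_apply (g j) (?y - ?x)\<bar> \<le> d" .
  qed
qed

text \<open>Passing to a separable invariant subspace, countably many functionals separate points, so
  a sequence of approximate fixed points suffices. The radial retraction \<open>\<rho>\<close> is only norm continuous,
  which is enough to build the subspace.\<close>

theorem weak_schauder:
  fixes T :: "'a::real_normed_vector \<Rightarrow> 'a"
  assumes refl: "reflexive_space TYPE('a)" and R: "R > 0"
    and T: "\<And>x. norm x \<le> R \<Longrightarrow> norm (T x) \<le> R"
    and cont: "\<And>u l. (\<And>n. norm (u n) \<le> R) \<Longrightarrow> weakly_converges u l \<Longrightarrow>
      weakly_converges (\<lambda>n. T (u n)) (T l)"
  obtains x where "norm x \<le> R" "T x = x"
proof -
  \<comment> \<open>Sums and multiples leave the ball, outside of which nothing is known about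
    \<open>T\<close>. Precomposing with this retraction allows the invariant hull to be built in the
    whole space.\<close>
  define \<rho> where "\<rho> x = (R / max R (norm x)) *\<^sub>R x" for x :: 'a
  have \<rho>R: "norm (\<rho> x) \<le> R" for x
    using R unfolding \<rho>_def by (cases "norm x \<le> R") (simp_all add: max_def)
  have \<rho>_id: "\<rho> x = x" if "norm x \<le> R" for x
    using R that unfolding \<rho>_def by simp
  obtain D where D: "countable D" "{0} \<subseteq> D" "(\<lambda>x. T (\<rho> x)) ` D \<subseteq> D" "subspace (closure D)"
    by (rule countable_invariant_hull[of "{0}" "\<lambda>x. T (\<rho> x)"]) auto
  define Y where "Y = closure D"
  define K where "K = {x \<in> Y. norm x \<le> R}"
  have Y: "subspace Y" "closed Y" using D(4) unfolding Y_def by simp_all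
  \<comment> \<open>Points of \<open>K\<close> are norm limits of points of \<open>D\<close>, whose
    images converge only weakly; the closed subspace \<open>Y\<close> still contains the limit
    because it is weakly sequentially closed.\<close>
  have TK: "T x \<in> K" if x: "x \<in> K" for x
  proof -
    obtain d where d: "\<forall>n. d n \<in> D" "d \<longlonglongrightarrow> x"
      using x unfolding K_def Y_def closure_sequential by blast
    have "(\<lambda>n. \<rho> (d n)) \<longlonglongrightarrow> \<rho> x"
      unfolding \<rho>_def using d(2) R
      by (intro tendsto_scaleR tendsto_divide tendsto_max tendsto_const tendsto_norm) auto
    then have "(\<lambda>n. \<rho> (d n)) \<longlonglongrightarrow> x" using \<rho>_id x unfolding K_def by simp
    then have "weakly_converges (\<lambda>n. T (\<rho> (d n))) (T x)"
      by (intro cont \<rho>R tendsto_imp_weakly_converges)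
    moreover have "T (\<rho> (d n)) \<in> Y" for n
      using D(3) d(1) closure_subset unfolding Y_def by blast
    ultimately have "T x \<in> Y" using weakly_converges_closed_subspace Y by blast
    then show ?thesis using T x unfolding K_def by simp
  qed
  have "convex K"
    unfolding K_def using subspace_imp_convex[OF Y(1)] convex_cball[of "0::'a" R]
    by (simp add: convex_Int Collect_conj_eq cball_def)
  have "0 \<in> K" unfolding K_def using subspace_0[OF Y(1)] R by simp
  obtain G :: "('a \<Rightarrow>\<^sub>L real) set" where G: "countable G"
      "\<And>y. y \<in> Y \<Longrightarrow> (\<And>\<phi>. \<phi> \<in> G \<Longrightarrow> blinfun_apply \<phi> y = 0) \<Longrightarrow> y = 0"
    unfolding Y_def by (rule countable_norming_family[OF D(1)]) blast
  \<comment> \<open>The zero functional makes the family nonempty, so that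
    \<open>from_nat_into\<close> enumerates exactly this set.\<close>
  define g where "g = from_nat_into (insert 0 G)"
  have g: "range g = insert 0 G" unfolding g_def using G(1) by (intro range_from_nat_into) auto
  have KR: "norm x \<le> R" if "x \<in> K" for x using that unfolding K_def by simp
  have K_cont: "weakly_converges (\<lambda>k. T (u k)) (T x)" if "\<And>k. u k \<in> K" "u \<longlonglongrightarrow> x" for u x
    using KR that by (intro cont tendsto_imp_weakly_converges) auto
  have "\<exists>x. x \<in> K \<and> (\<forall>j<m. \<bar>blinfun_apply (g j) (T x - x)\<bar> \<le> 1 / real (Suc m))" for m
  proof -
    have pos: "0 < 1 / real (Suc m)" by simp
    obtain x where "x \<in> K" "\<forall>j<m. \<bar>blinfun_apply (g j) (T x - x)\<bar> \<le> 1 / real (Suc m)"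
      by (rule approximate_fixed_point[of K R T "1 / real (Suc m)" m g,
            OF \<open>convex K\<close> \<open>0 \<in> K\<close> KR TK K_cont pos])
    then show ?thesis by blast
  qed
  then obtain xs where xs: "\<And>m. xs m \<in> K"
      "\<And>m. \<forall>j<m. \<bar>blinfun_apply (g j) (T (xs m) - xs m)\<bar> \<le> 1 / real (Suc m)"
    by metis
  have xsR: "norm (xs m) \<le> R" for m by (rule KR[OF xs(1)])
  obtain x r where r: "strict_mono (r::nat\<Rightarrow>nat)" and x: "weakly_converges (\<lambda>m. xs (r m)) x"
    by (rule reflexive_weakly_seq_compact[OF refl xsR])
  have "x \<in> Y"
    using weakly_converges_closed_subspace[OF x _ Y] xs(1) unfolding K_def by blast
  moreover have "norm x \<le> R" by (rule weakly_converges_norm_le[OF x xsR])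
  ultimately have xK: "x \<in> K" unfolding K_def by simp
  have "weakly_converges (\<lambda>m. T (xs (r m)) + (-1) *\<^sub>R xs (r m)) (T x + (-1) *\<^sub>R x)"
    by (intro weakly_converges_add weakly_converges_scaleR cont x xsR)
  then have lim: "weakly_converges (\<lambda>m. T (xs (r m)) - xs (r m)) (T x - x)" by simp
  \<comment> \<open>Each fixed \<open>g j\<close> is among the tested functionals as soon as
    \<open>m > j\<close>, and the tolerance tends to zero.\<close>
  have "blinfun_apply (g j) (T x - x) = 0" for j
  proof (rule LIMSEQ_unique)
    show "(\<lambda>m. blinfun_apply (g j) (T (xs (r m)) - xs (r m))) \<longlonglongrightarrow> blinfun_apply (g j) (T x - x)"
      using lim unfolding weakly_converges_def by blast
    have "norm (blinfun_apply (g j) (T (xs (r m)) - xs (r m))) \<le> 1 / real (Suc m)" if "m > j" for m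
    proof -
      have "r m \<ge> m" by (rule seq_suble[OF r])
      then have "\<bar>blinfun_apply (g j) (T (xs (r m)) - xs (r m))\<bar> \<le> 1 / real (Suc (r m))"
        using xs(2)[of "r m"] that by simp
      also have "\<dots> \<le> 1 / real (Suc m)" using \<open>r m \<ge> m\<close> by (intro divide_left_mono) simp_all
      finally show ?thesis by simp
    qed
    then have "\<forall>\<^sub>F m in sequentially. norm (blinfun_apply (g j) (T (xs (r m)) - xs (r m))) \<le> 1 / real (Suc m)"
      by (intro eventually_mono[OF eventually_gt_at_top[of j]]) blast
    then show "(\<lambda>m. blinfun_apply (g j) (T (xs (r m)) - xs (r m))) \<longlonglongrightarrow> 0"
      by (rule Lim_null_comparison) (rule LIMSEQ_Suc[OF lim_1_over_n])
  qed
  then have "blinfun_apply \<phi> (T x - x) = 0" if "\<phi> \<in> G" for \<phi>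
    using g that by (metis insertCI rangeE)
  moreover have "T x - x \<in> Y"
    using TK[OF xK] xK subspace_diff[OF Y(1)] unfolding K_def by blast
  ultimately have "T x - x = 0" using G(2) by blast
  then show thesis using that[of x] KR[OF xK] by simp
qed

section \<open>The resolvent and the operator equation\<close>

text \<open>Weak continuity comes from identifying limits: if \<open>S (v n)\<close> tends weakly to
  \<open>u\<close> along a subsequence, weak continuity of \<open>B\<close> gives
  \<open>u = l + e *\<^sub>R B u\<close>, and the contraction principle leaves only
  \<open>u = S l\<close>.\<close>

lemma expanding_resolvent:
  fixes B :: "'a::banach \<Rightarrow> 'a"
  assumes refl: "reflexive_space TYPE('a)" and B: "seq_weakly_continuous B" "expanding B"
    and L: "L-lipschitz_on UNIV B" and e: "e > 0" "e * L < 1"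
  obtains S where "\<And>v. S v = v + e *\<^sub>R B (S v)" "\<And>v. norm (S v) \<le> norm v"
    "\<And>v l C. (\<And>n. norm (v n) \<le> C) \<Longrightarrow> weakly_converges v l \<Longrightarrow> weakly_converges (\<lambda>n. S (v n)) (S l)"
proof -
  have ex1: "\<exists>!u. v + e *\<^sub>R B u = u" for v
  proof (rule banach_fix_type)
    show "0 \<le> e * L" using e(1) lipschitz_on_nonneg[OF L] by simp
    show "\<forall>x y. dist (v + e *\<^sub>R B x) (v + e *\<^sub>R B y) \<le> e * L * dist x y"
    proof (intro allI)
      fix x y
      have "dist (v + e *\<^sub>R B x) (v + e *\<^sub>R B y) = e * dist (B x) (B y)"
        using e(1) by (simp add: dist_norm flip: scaleR_diff_right)
      also have "\<dots> \<le> e * (L * dist x y)"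
        using lipschitz_onD[OF L] e(1) by (intro mult_left_mono) simp_all
      finally show "dist (v + e *\<^sub>R B x) (v + e *\<^sub>R B y) \<le> e * L * dist x y" by (simp add: mult.assoc)
    qed
  qed (rule e(2))
  define S where "S v = (THE u. v + e *\<^sub>R B u = u)" for v
  have S: "S v = v + e *\<^sub>R B (S v)" for v
    using theI'[OF ex1[of v]] unfolding S_def by simp
  have S_norm: "norm (S v) \<le> norm v" for v
  proof -
    have "norm (S v) \<le> norm (S v - e *\<^sub>R B (S v))" using B(2) e(1) unfolding expanding_def by blast
    also have "S v - e *\<^sub>R B (S v) = v" unfolding diff_eq_eq by (rule S)
    finally show ?thesis .
  qed
  show thesis
  proof (rule that[OF S S_norm])
    fix v :: "nat \<Rightarrow> 'a" and l C
    assume v: "\<And>n. norm (v n) \<le> C" and l: "weakly_converges v l"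
    show "weakly_converges (\<lambda>n. S (v n)) (S l)"
    proof (rule weakly_converges_if_subsubseq)
      fix r :: "nat \<Rightarrow> nat" assume r: "strict_mono r"
      have "norm (S (v (r n))) \<le> C" for n by (rule order_trans[OF S_norm v])
      then obtain u s where s: "strict_mono (s::nat\<Rightarrow>nat)"
          and u: "weakly_converges (\<lambda>n. S (v (r (s n)))) u"
        by (rule reflexive_weakly_seq_compact[OF refl, of "\<lambda>n. S (v (r n))" C])
      have "weakly_converges (\<lambda>n. v (r (s n)) + e *\<^sub>R B (S (v (r (s n))))) (l + e *\<^sub>R B u)"
      proof (intro weakly_converges_add weakly_converges_scaleR)
        show "weakly_converges (\<lambda>n. v (r (s n))) l"
          using weakly_converges_subseq[OF weakly_converges_subseq[OF l r] s] .
        show "weakly_converges (\<lambda>n. B (S (v (r (s n))))) (B u)"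
          using B(1) u unfolding seq_weakly_continuous_def by blast
      qed
      then have "weakly_converges (\<lambda>n. S (v (r (s n)))) (l + e *\<^sub>R B u)"
        by (simp only: S[symmetric])
      then have "l + e *\<^sub>R B u = u" by (rule weakly_converges_unique[OF _ u])
      then have "u = S l" using ex1[of l] S[of l] by metis
      then show "\<exists>s. strict_mono s \<and> weakly_converges (\<lambda>n. S (v (r (s n)))) (S l)"
        using s u by blast
    qed
  qed
qed

theorem theorem3p2:
  fixes A B :: "'a::banach \<Rightarrow> 'a" and R :: real
  assumes "reflexive_space TYPE('a)"
    and "seq_weakly_continuous A"
    and "seq_weakly_continuous B"
    and "R > 0"
    and "A ` cball 0 R \<subseteq> cball 0 R"
    and "\<exists>L. L-lipschitz_on UNIV B"
    and "expanding B"
  shows "\<forall>c\<ge>0. \<exists>u. A u + c *\<^sub>R B u = u"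
proof (intro allI impI)
  fix c :: real assume "c \<ge> 0"
  have A: "norm (A x) \<le> R" if "norm x \<le> R" for x
    using assms(5) that by (simp add: image_subset_iff)
  have A_cont: "weakly_converges (\<lambda>n. A (u n)) (A l)" if "weakly_converges u l" for u l
    using assms(2) that unfolding seq_weakly_continuous_def by blast
  show "\<exists>u. A u + c *\<^sub>R B u = u"
  \<comment> \<open>The weight \<open>e / c\<close> needs \<open>c > 0\<close>; for
    \<open>c = 0\<close> the equation is the fixed point problem for \<open>A\<close> alone.\<close>
  proof (cases "c = 0")
    case True
    obtain u where "A u = u" by (rule weak_schauder[OF assms(1,4) A A_cont])
    then show ?thesis using True by (intro exI[of _ u]) simp
  next
    case False
    with \<open>c \<ge> 0\<close> have c: "c > 0" by simp
    obtain L where L: "L-lipschitz_on UNIV B" using assms(6) by blast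
    have L0: "L \<ge> 0" by (rule lipschitz_on_nonneg[OF L])
    \<comment> \<open>The bound by \<open>c\<close> makes \<open>\<theta> \<le> 1\<close>, and the
      other one makes \<open>e * L < 1\<close>; \<open>L + 1\<close> keeps the denominator positive
      when \<open>L = 0\<close>.\<close>
    define e where "e = min c (1 / (L + 1))"
    have e: "e > 0" "e \<le> c" using c L0 unfolding e_def by simp_all
    have "e * L \<le> 1 / (L + 1) * L" unfolding e_def using L0 by (intro mult_right_mono) simp_all
    also have "\<dots> < 1" using L0 by (simp add: divide_less_eq)
    finally obtain S where S: "\<And>v. S v = v + e *\<^sub>R B (S v)" "\<And>v. norm (S v) \<le> norm v"
      "\<And>v l C. (\<And>n. norm (v n) \<le> C) \<Longrightarrow> weakly_converges v l \<Longrightarrow> weakly_converges (\<lambda>n. S (v n)) (S l)"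
      by (rule expanding_resolvent[OF assms(1,3,7) L e(1)]) blast
    define \<theta> where "\<theta> = e / c"
    have \<theta>: "0 < \<theta>" "\<theta> \<le> 1" using e c unfolding \<theta>_def by simp_all
    define T where "T w = (1 - \<theta>) *\<^sub>R S w + \<theta> *\<^sub>R A (S w)" for w
    obtain w where w: "T w = w"
    proof (rule weak_schauder[OF assms(1,4), of T])
      fix x :: 'a assume x: "norm x \<le> R"
      then have "norm (S x) \<le> R" using S(2)[of x] by simp
      then have "S x \<in> cball 0 R" "A (S x) \<in> cball 0 R" using A by simp_all
      then have "T x \<in> cball 0 R"
        unfolding T_def using \<theta> by (intro convexD[OF convex_cball]) simp_all
      then show "norm (T x) \<le> R" by simp
    next
      fix u :: "nat \<Rightarrow> 'a" and l
      assume u: "\<And>n. norm (u n) \<le> R" "weakly_converges u l"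
      show "weakly_converges (\<lambda>n. T (u n)) (T l)"
        unfolding T_def by (intro weakly_converges_add weakly_converges_scaleR A_cont S(3)[OF u])
    qed blast
    let ?u = "S w"
    have "(1 - \<theta>) *\<^sub>R ?u + \<theta> *\<^sub>R A ?u + e *\<^sub>R B ?u = ?u"
      using w S(1)[of w] unfolding T_def by metis
    \<comment> \<open>Since \<open>e = \<theta> * c\<close>, the positive factor
      \<open>\<theta>\<close> can be extracted from the whole equation and cancelled.\<close>
    moreover have "e *\<^sub>R B ?u = \<theta> *\<^sub>R (c *\<^sub>R B ?u)" unfolding \<theta>_def using c by simp
    ultimately have "\<theta> *\<^sub>R (A ?u + c *\<^sub>R B ?u - ?u) = 0" by (simp add: algebra_simps)
    then have "A ?u + c *\<^sub>R B ?u = ?u" using \<theta>(1) by simp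
    then show ?thesis by blast
  qed
qed

end
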